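(* Let $s,t\ge 2$ be integers, and let $G$ be a $C_4$-free graph such that every non-empty induced subgraph of $G$ has a bisimplicial vertex. If $\omega(G)<\chi(G)=s+t-1$, then $G$ is $(s,t)$-splittable.
   Context: All graphs are finite and simple. $\omega(G)$ denotes the clique number and $\chi(G)$ the chromatic number of $G$. For $A\subseteq V(G)$, $G[A]$ is the subgraph of $G$ induced by $A$. A clique is a set of pairwise adjacent vertices (the empty set is allowed). A graph is $C_4$-free if it does not contain the cycle $C_4$ on four vertices as an induced subgraph. A vertex of a graph is bisimplicial if the set of its neighbors (in that graph) can be expressed as the union of two cliques. For positive integers $s,t$, a graph $G$ is $(s,t)$-splittable if $V(G)$ can be partitioned into two sets $S$ and $T$ such that $\chi(G[S])\ge s$ and $\chi(G[T])\ge t$. *)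

theory Defs
  imports "Graph_Theory.Digraph_Component"
begin

text \<open>
  Finite simple graphs are modelled by the locale \<open>graph\<close> of \<open>Graph_Theory\<close>: finite loop-free
  symmetric digraphs without parallel arcs, each undirected edge being a pair of opposite arcs.
  Adjacency is \<open>u \<rightarrow>\<^bsub>G\<^esub> v\<close>, and \<open>G \<restriction> A\<close> is the subgraph of \<open>G\<close> induced by \<open>A\<close>.
\<close>

definition clique :: "('a, 'b) pre_digraph \<Rightarrow> 'a set \<Rightarrow> bool" where
  "clique G K \<longleftrightarrow> K \<subseteq> verts G \<and> (\<forall>u\<in>K. \<forall>v\<in>K. u \<noteq> v \<longrightarrow> u \<rightarrow>\<^bsub>G\<^esub> v)"

definition clique_number :: "('a, 'b) pre_digraph \<Rightarrow> nat" where
  "clique_number G = Max {card K |K. clique G K}"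

definition proper_coloring :: "('a, 'b) pre_digraph \<Rightarrow> nat \<Rightarrow> ('a \<Rightarrow> nat) \<Rightarrow> bool" where
  "proper_coloring G k c \<longleftrightarrow>
     (\<forall>v\<in>verts G. c v < k) \<and>
     (\<forall>u\<in>verts G. \<forall>v\<in>verts G. u \<rightarrow>\<^bsub>G\<^esub> v \<longrightarrow> c u \<noteq> c v)"

definition chromatic_number :: "('a, 'b) pre_digraph \<Rightarrow> nat" where
  "chromatic_number G = (LEAST k. \<exists>c. proper_coloring G k c)"

definition cycle4 :: "('a, 'b) pre_digraph \<Rightarrow> bool" where
  "cycle4 H \<longleftrightarrow> graph H \<and>
     (\<exists>a b c d. distinct [a, b, c, d] \<and> verts H = {a, b, c, d} \<and>
        arcs_ends H = {(a, b), (b, a), (b, c), (c, b), (c, d), (d, c), (d, a), (a, d)})"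

definition C4_free :: "('a, 'b) pre_digraph \<Rightarrow> bool" where
  "C4_free G \<longleftrightarrow> \<not> (\<exists>H. induced_subgraph H G \<and> cycle4 H)"

definition neighbors :: "('a, 'b) pre_digraph \<Rightarrow> 'a \<Rightarrow> 'a set" where
  "neighbors G v = {u \<in> verts G. v \<rightarrow>\<^bsub>G\<^esub> u}"

definition bisimplicial :: "('a, 'b) pre_digraph \<Rightarrow> 'a \<Rightarrow> bool" where
  "bisimplicial G v \<longleftrightarrow> v \<in> verts G \<and>
     (\<exists>K L. clique G K \<and> clique G L \<and> neighbors G v = K \<union> L)"

definition splittable :: "nat \<Rightarrow> nat \<Rightarrow> ('a, 'b) pre_digraph \<Rightarrow> bool" where
  "splittable s t G \<longleftrightarrow>
     (\<exists>S T. S \<union> T = verts G \<and> S \<inter> T = {} \<and>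
        s \<le> chromatic_number (G \<restriction> S) \<and> t \<le> chromatic_number (G \<restriction> T))"

end

theory Submission
  imports Defs
begin

text \<open>
  Passing to a vertex-critical induced subgraph, a bisimplicial vertex \<open>v\<close> has degree at least
  \<open>s + t - 2\<close>, so its neighbourhood is a disjoint union of cliques \<open>A\<close>, \<open>B\<close> with \<open>|A| \<ge> s - 1\<close>, up to
  exchanging \<open>s\<close> and \<open>t\<close>. By \<open>C\<^sub>4\<close>-freeness the vertices of \<open>A\<close> have nested neighbourhoods in \<open>B\<close>;
  choose \<open>a \<in> A\<close> with the smallest one. Then \<open>v\<close>, \<open>a\<close> and their common neighbours form a clique \<open>Q\<close>.
  Let \<open>K\<close> consist of \<open>v\<close> and \<open>s - 1\<close> vertices of \<open>A\<close> including \<open>a\<close>. If the graph does not split, then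
  \<open>G - K\<close> is \<open>(t - 1)\<close>-colourable, and a recolouring argument shows that \<open>v\<close> and \<open>a\<close> have a common
  neighbour in every colour class. Hence \<open>|Q| \<ge> s + t - 1\<close>, contradicting \<open>\<omega> < \<chi>\<close>.
\<close>

section \<open>Colourings, cliques and splittings under induced subgraphs\<close>

lemma adj_induce_iff: "u \<rightarrow>\<^bsub>G \<restriction> S\<^esub> v \<longleftrightarrow> u \<in> S \<and> v \<in> S \<and> u \<rightarrow>\<^bsub>G\<^esub> v"
  by (force simp: arcs_ends_conv)

lemma induce_induce: "S \<subseteq> U \<Longrightarrow> (G \<restriction> U) \<restriction> S = G \<restriction> S"
  by (auto simp: induce_subgraph_def)

lemma (in wf_digraph) induce_verts: "G \<restriction> verts G = G"
  by (rule pre_digraph.equality) auto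

lemma induced_subgraph_trans:
  assumes "induced_subgraph J H" "induced_subgraph H G" shows "induced_subgraph J G"
  using assms
  by (auto simp: induced_subgraph_def subgraph_def compatible_def)

lemma proper_coloring_induce_iff:
  "proper_coloring (G \<restriction> U) k c \<longleftrightarrow>
     (\<forall>v\<in>U. c v < k) \<and> (\<forall>u\<in>U. \<forall>v\<in>U. u \<rightarrow>\<^bsub>G\<^esub> v \<longrightarrow> c u \<noteq> c v)"
  by (auto simp: proper_coloring_def adj_induce_iff)

lemma (in digraph) chromatic_number_le_iff:
  "chromatic_number G \<le> k \<longleftrightarrow> (\<exists>c. proper_coloring G k c)"
proof
  assume le: "chromatic_number G \<le> k"
  obtain f :: "'a \<Rightarrow> nat" where f: "f ` verts G = {0..<card (verts G)}" "inj_on f (verts G)"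
    using ex_bij_betw_finite_nat[OF finite_verts] by (auto simp: bij_betw_def)
  have "proper_coloring G (card (verts G)) f"
    unfolding proper_coloring_def
  proof (intro conjI ballI impI)
    show "f v < card (verts G)" if "v \<in> verts G" for v using f(1) that by auto
    show "f u \<noteq> f v" if "u \<in> verts G" "v \<in> verts G" "u \<rightarrow> v" for u v
      using inj_onD[OF f(2), of u v] that adj_not_same by blast
  qed
  then have "\<exists>k c. proper_coloring G k c" by blast
  then have "\<exists>c. proper_coloring G (chromatic_number G) c"
    unfolding chromatic_number_def by (rule LeastI_ex)
  then obtain c where c: "proper_coloring G (chromatic_number G) c" ..
  have "proper_coloring G k c"
    using c le unfolding proper_coloring_def by (auto intro: less_le_trans)
  then show "\<exists>c. proper_coloring G k c" by blast
next
  assume "\<exists>c. proper_coloring G k c"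
  then show "chromatic_number G \<le> k"
    unfolding chromatic_number_def by (rule Least_le)
qed

lemma (in graph) graph_induce: "U \<subseteq> verts G \<Longrightarrow> graph (G \<restriction> U)"
proof -
  assume U: "U \<subseteq> verts G"
  then interpret U: digraph "G \<restriction> U" by (intro digraphI_induced induced_induce)
  show "graph (G \<restriction> U)"
    by unfold_locales (simp add: symmetric_def sym_def adj_induce_iff graph_symmetric)
qed

lemma (in graph) chromatic_number_induce_le_iff:
  assumes "U \<subseteq> verts G"
  shows "chromatic_number (G \<restriction> U) \<le> k \<longleftrightarrow>
    (\<exists>c. (\<forall>v\<in>U. c v < k) \<and> (\<forall>u\<in>U. \<forall>v\<in>U. u \<rightarrow>\<^bsub>G\<^esub> v \<longrightarrow> c u \<noteq> c v))"
proof -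
  have "digraph (G \<restriction> U)" using assms by (intro digraphI_induced induced_induce)
  then show ?thesis
    by (simp only: digraph.chromatic_number_le_iff proper_coloring_induce_iff)
qed

lemma (in graph) chromatic_number_induce_mono:
  assumes "S \<subseteq> U" "U \<subseteq> verts G"
  shows "chromatic_number (G \<restriction> S) \<le> chromatic_number (G \<restriction> U)"
proof -
  obtain c where "\<forall>v\<in>U. c v < chromatic_number (G \<restriction> U)"
      "\<forall>u\<in>U. \<forall>v\<in>U. u \<rightarrow>\<^bsub>G\<^esub> v \<longrightarrow> c u \<noteq> c v"
    using chromatic_number_induce_le_iff[OF assms(2)] by blast
  then show ?thesis
    using assms by (subst chromatic_number_induce_le_iff) (auto intro!: exI[of _ c])
qed

lemma (in graph) card_clique_le_chromatic_number_induce: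
  assumes K: "clique G K"
  shows "card K \<le> chromatic_number (G \<restriction> K)"
proof -
  have "K \<subseteq> verts G" using K by (simp add: clique_def)
  then obtain c where c: "\<forall>v\<in>K. c v < chromatic_number (G \<restriction> K)"
      "\<forall>u\<in>K. \<forall>v\<in>K. u \<rightarrow>\<^bsub>G\<^esub> v \<longrightarrow> c u \<noteq> c v"
    using chromatic_number_induce_le_iff by blast
  have "inj_on c K" using c(2) K unfolding clique_def inj_on_def by metis
  moreover have "c ` K \<subseteq> {..<chromatic_number (G \<restriction> K)}" using c(1) by auto
  ultimately show ?thesis by (metis card_inj_on_le card_lessThan finite_lessThan)
qed

text \<open>The maximum is meaningful: there are finitely many cliques, and the empty one always
  exists.\<close>

lemma (in fin_digraph) clique_number_le_iff:
  "clique_number G \<le> n \<longleftrightarrow> (\<forall>K. clique G K \<longrightarrow> card K \<le> n)"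
proof -
  have "{card K |K. clique G K} \<subseteq> card ` Pow (verts G)" by (auto simp: clique_def)
  then have "finite {card K |K. clique G K}" by (rule finite_subset) simp
  moreover have "clique G {}" by (simp add: clique_def)
  ultimately show ?thesis unfolding clique_number_def by (subst Max_le_iff) auto
qed

text \<open>Disjoint sets suffice, since vertices outside both can be added to \<open>T\<close>
  without lowering its chromatic number.\<close>

lemma (in graph) splittableI:
  assumes "S \<subseteq> verts G" "T \<subseteq> verts G" "S \<inter> T = {}"
    and "s \<le> chromatic_number (G \<restriction> S)" "t \<le> chromatic_number (G \<restriction> T)"
  shows "splittable s t G"
proof -
  have "chromatic_number (G \<restriction> T) \<le> chromatic_number (G \<restriction> (verts G - S))"
    using assms by (intro chromatic_number_induce_mono) auto
  with assms show ?thesis unfolding splittable_def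
    by (intro exI[of _ S] exI[of _ "verts G - S"]) auto
qed

lemma splittable_commute: "splittable s t G \<longleftrightarrow> splittable t s G"
  unfolding splittable_def by (metis Int_commute Un_commute)

lemma (in graph) splittable_induce:
  assumes "U \<subseteq> verts G" "splittable s t (G \<restriction> U)"
  shows "splittable s t G"
proof -
  obtain S T where "S \<union> T = U" "S \<inter> T = {}"
      "s \<le> chromatic_number ((G \<restriction> U) \<restriction> S)" "t \<le> chromatic_number ((G \<restriction> U) \<restriction> T)"
    using assms(2) by (auto simp: splittable_def)
  moreover from this have "S \<subseteq> U" "T \<subseteq> U" by auto
  ultimately show ?thesis
    using assms(1) by (intro splittableI[of S T]) (auto simp: induce_induce)
qed

section \<open>Critical vertices, recolouring and four-cycles\<close>

lemma (in graph) adj_sym: "u \<rightarrow>\<^bsub>G\<^esub> v \<longleftrightarrow> v \<rightarrow>\<^bsub>G\<^esub> u"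
  using graph_symmetric by blast

text \<open>With fewer neighbours, some colour of an optimal colouring of the graph without
  \<open>v\<close> would be free at \<open>v\<close>, and no new colour would be required.\<close>

lemma (in graph) chromatic_number_le_Suc_degree:
  assumes v: "v \<in> verts G"
    and crit: "chromatic_number (G \<restriction> (verts G - {v})) < chromatic_number G"
  shows "chromatic_number G \<le> Suc (card (neighbors G v))"
proof (rule ccontr)
  define m where "m = chromatic_number G - 1"
  assume "\<not> ?thesis"
  then have lt: "card (neighbors G v) < m" by (simp add: m_def)
  have "chromatic_number (G \<restriction> (verts G - {v})) \<le> m" using crit by (simp add: m_def)
  then obtain c where c: "\<forall>u\<in>verts G - {v}. c u < m"
      "\<forall>u\<in>verts G - {v}. \<forall>w\<in>verts G - {v}. u \<rightarrow>\<^bsub>G\<^esub> w \<longrightarrow> c u \<noteq> c w"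
    using chromatic_number_induce_le_iff[of "verts G - {v}" m] by blast
  have fin: "finite (neighbors G v)" by (simp add: neighbors_def)
  have "card (c ` neighbors G v) < m" using card_image_le[OF fin, of c] lt by simp
  then have "\<not> {..<m} \<subseteq> c ` neighbors G v"
    using card_mono[of "c ` neighbors G v" "{..<m}"] fin by auto
  then obtain i where i: "i < m" "i \<notin> c ` neighbors G v" by auto
  have "proper_coloring G m (c(v := i))"
    using c i adj_not_same adj_sym unfolding proper_coloring_def neighbors_def by auto
  then have "chromatic_number G \<le> m" using chromatic_number_le_iff by blast
  then show False using crit by (simp add: m_def)
qed

text \<open>Extending \<open>c\<close> by a fresh colour for each vertex of \<open>K\<close> uses
  \<open>m + card K\<close> colours, so \<open>chrom\<close> makes that extension optimal and any
  saving absurd.\<close>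

lemma (in graph) common_neighbor_of_color:
  assumes K: "clique G K" and chrom: "m + card K \<le> chromatic_number G"
    and x: "x \<in> K" and y: "y \<in> K" and "x \<noteq> y"
    and c: "\<forall>v\<in>verts G - K. c v < m"
      "\<forall>u\<in>verts G - K. \<forall>v\<in>verts G - K. u \<rightarrow>\<^bsub>G\<^esub> v \<longrightarrow> c u \<noteq> c v"
    and i: "i < m"
  shows "\<exists>z\<in>verts G - K. c z = i \<and> x \<rightarrow>\<^bsub>G\<^esub> z \<and> y \<rightarrow>\<^bsub>G\<^esub> z"
proof (rule ccontr)
  assume none: "\<not> ?thesis"
  have KV: "K \<subseteq> verts G" using K by (simp add: clique_def)
  then have fin: "finite K" using finite_verts finite_subset by blast
  define R where "R = K - {x, y}"
  have cardK: "card K = card R + 2"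
    using fin x y \<open>x \<noteq> y\<close> card_Diff_subset[of "{x, y}" K] card_mono[of K "{x, y}"]
    by (simp add: R_def)
  obtain f :: "'a \<Rightarrow> nat" where f: "f ` R = {0..<card R}" "inj_on f R"
    using ex_bij_betw_finite_nat[of R] fin by (auto simp: bij_betw_def R_def)
  \<comment> \<open>Recolour \<open>x\<close> with \<open>i\<close>, and its neighbours of colour \<open>i\<close> with the new colour of \<open>y\<close>;
    this saves one colour.\<close>
  define d where "d v =
      (if v = x then i else if v = y then m else if v \<in> K then Suc m + f v
       else if c v = i \<and> x \<rightarrow>\<^bsub>G\<^esub> v then m else c v)" for v
  have R_lt: "f v < card R" if "v \<in> K" "v \<noteq> x" "v \<noteq> y" for v
    using f(1) that by (auto simp: R_def)
  \<comment> \<open>The set \<open>R\<close> takes the colours from \<open>m + 1\<close> to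
    \<open>m + card K - 2\<close>, so \<open>m + card K - 1\<close> colours suffice.\<close>
  have lt: "d v < m + card K - 1" if "v \<in> verts G" for v
    using R_lt[of v] c(1) i that cardK by (auto simp: d_def dest: bspec)
  have cm: "c v < m" "c v \<noteq> m" "c v \<noteq> Suc (m + j)" if "v \<in> verts G - K" for v j
    using c(1) that by (auto dest: bspec)
  \<comment> \<open>Neighbours of \<open>x\<close> have lost colour \<open>i\<close>. A vertex
    outside \<open>K\<close> coloured \<open>m\<close> had colour \<open>i\<close> and is adjacent
    to \<open>x\<close>, so by \<open>none\<close> it is not adjacent to \<open>y\<close>.\<close>
  have neq: "d u \<noteq> d v" if "u \<in> K" "v \<in> verts G - K" "u \<rightarrow>\<^bsub>G\<^esub> v" for u v
    using that none x y i cm[OF that(2)] \<open>x \<noteq> y\<close> by (auto simp: d_def)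
  have neqK: "d u \<noteq> d v" if "u \<in> K" "v \<in> K" "u \<noteq> v" for u v
    using that i inj_onD[OF f(2), of u v] \<open>x \<noteq> y\<close> by (auto simp: d_def R_def)
  \<comment> \<open>The vertices moved to \<open>m\<close> all had colour \<open>i\<close> under
    \<open>c\<close>, hence are pairwise non-adjacent.\<close>
  have neqR: "d u \<noteq> d v" if "u \<in> verts G - K" "v \<in> verts G - K" "u \<rightarrow>\<^bsub>G\<^esub> v" for u v
  proof -
    have "c u \<noteq> c v" using that c(2) by blast
    then show ?thesis using that cm[OF that(1)] cm[OF that(2)] x y by (auto simp: d_def)
  qed
  have "d u \<noteq> d v" if "u \<in> verts G" "v \<in> verts G" "u \<rightarrow>\<^bsub>G\<^esub> v" for u v
  proof -
    have "u \<noteq> v" "v \<rightarrow>\<^bsub>G\<^esub> u" using that adj_not_same adj_sym by blast+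
    then show ?thesis
      using that neq[of u v] neq[of v u] neqK[of u v] neqR[of u v]
      by (cases "u \<in> K"; cases "v \<in> K") auto
  qed
  then have "proper_coloring G (m + card K - 1) d"
    using lt by (auto simp: proper_coloring_def)
  then have "chromatic_number G \<le> m + card K - 1" using chromatic_number_le_iff by blast
  then show False using chrom cardK by simp
qed

lemma (in graph) no_induced_C4:
  assumes "C4_free G" and "distinct [a, b, c, d]"
    and "a \<rightarrow>\<^bsub>G\<^esub> b" "b \<rightarrow>\<^bsub>G\<^esub> c" "c \<rightarrow>\<^bsub>G\<^esub> d" "d \<rightarrow>\<^bsub>G\<^esub> a"
  shows "a \<rightarrow>\<^bsub>G\<^esub> c \<or> b \<rightarrow>\<^bsub>G\<^esub> d"
proof (rule ccontr)
  assume none: "\<not> ?thesis"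
  let ?W = "{a, b, c, d}"
  have W: "?W \<subseteq> verts G" using assms(3-6) adj_in_verts by blast
  have "arcs_ends (G \<restriction> ?W) = {(u, v). u \<in> ?W \<and> v \<in> ?W \<and> u \<rightarrow>\<^bsub>G\<^esub> v}"
    by (auto simp: adj_induce_iff)
  also have "\<dots> = {(a, b), (b, a), (b, c), (c, b), (c, d), (d, c), (d, a), (a, d)}"
    using assms(3-6) none adj_sym adj_not_same by auto
  finally have "cycle4 (G \<restriction> ?W)"
    unfolding cycle4_def using graph_induce[OF W] assms(2) by auto
  then show False using assms(1) induced_induce[OF W] by (auto simp: C4_free_def)
qed

section \<open>A large clique at a bisimplicial vertex\<close>

lemma (in graph) splittable_of_large_side:
  assumes C4: "C4_free G" and omega: "clique_number G < chromatic_number G"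
    and chrom: "chromatic_number G = s + t - 1" and "s \<ge> 2" "t \<ge> 1"
    and v: "v \<in> verts G" and A: "clique G A" and B: "clique G B" and disj: "A \<inter> B = {}"
    and N: "neighbors G v = A \<union> B" and large: "s - 1 \<le> card A"
  shows "splittable s t G"
proof (rule ccontr)
  assume ns: "\<not> splittable s t G"
  have AV: "A \<subseteq> verts G" "B \<subseteq> verts G" using A B by (auto simp: clique_def)
  then have fin: "finite A" "finite B" using finite_verts finite_subset by blast+
  have vA: "u \<in> A \<union> B \<longleftrightarrow> u \<in> verts G \<and> v \<rightarrow>\<^bsub>G\<^esub> u" for u
    using N by (auto simp: neighbors_def)
  have vnot: "v \<notin> A" "v \<notin> B" using vA adj_not_same by blast+
  have "A \<noteq> {}" using large \<open>s \<ge> 2\<close> by auto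
  define NB where "NB a = {b \<in> B. a \<rightarrow>\<^bsub>G\<^esub> b}" for a
  obtain a0 where a0: "a0 \<in> A" "\<forall>a\<in>A. card (NB a0) \<le> card (NB a)"
    using ex_min_if_finite[of "(\<lambda>a. card (NB a)) ` A"] fin \<open>A \<noteq> {}\<close>
    by (metis (mono_tags, lifting) arg_min_least arg_min_if_finite(1))
  \<comment> \<open>Two edges between \<open>A\<close> and \<open>B\<close> never induce a matching in a \<open>C4\<close>-free graph, so the
    neighbourhoods in \<open>B\<close> of the vertices of \<open>A\<close> form a chain; \<open>NB a0\<close> is its least member.\<close>
  have complete: "a \<rightarrow>\<^bsub>G\<^esub> b" if "a \<in> A" "b \<in> NB a0" for a b
  proof (rule ccontr)
    assume nab: "\<not> a \<rightarrow>\<^bsub>G\<^esub> b"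
    \<comment> \<open>Minimal cardinality is enough here: \<open>b\<close> would make the inclusion
      proper.\<close>
    have "\<not> NB a \<subseteq> NB a0"
    proof
      assume "NB a \<subseteq> NB a0"
      moreover have "b \<in> NB a0 - NB a" using that nab by (auto simp: NB_def)
      ultimately have "NB a \<subset> NB a0" by blast
      then have "card (NB a) < card (NB a0)"
        using fin by (intro psubset_card_mono) (auto simp: NB_def)
      then show False using a0 that by (meson leD)
    qed
    then obtain b' where b': "b' \<in> B" "a \<rightarrow>\<^bsub>G\<^esub> b'" "\<not> a0 \<rightarrow>\<^bsub>G\<^esub> b'" by (auto simp: NB_def)
    have b: "b \<in> B" "a0 \<rightarrow>\<^bsub>G\<^esub> b" using that by (auto simp: NB_def)
    have "a \<noteq> a0" "b \<noteq> b'" using b' b nab by auto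
    \<comment> \<open>The four-cycle is \<open>a\<close>, \<open>a0\<close>, \<open>b\<close>,
      \<open>b'\<close>; both of its diagonals are missing.\<close>
    then have "distinct [a, a0, b, b']" "a \<rightarrow>\<^bsub>G\<^esub> a0" "b \<rightarrow>\<^bsub>G\<^esub> b'"
      using that a0 b b' disj A B by (auto simp: clique_def)
    then have "a \<rightarrow>\<^bsub>G\<^esub> b \<or> a0 \<rightarrow>\<^bsub>G\<^esub> b'"
      using no_induced_C4[OF C4] b b' adj_sym by blast
    then show False using nab b' by blast
  qed
  define Q where "Q = insert v (A \<union> NB a0)"
  have Q: "clique G Q"
    unfolding clique_def
  proof (intro conjI ballI impI)
    show "Q \<subseteq> verts G" using v AV by (auto simp: Q_def NB_def)
  next
    fix u w assume "u \<in> Q" "w \<in> Q" "u \<noteq> w"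
    moreover have "v \<rightarrow>\<^bsub>G\<^esub> u" if "u \<in> A \<union> NB a0" for u
      using that vA by (auto simp: NB_def)
    moreover have "u \<rightarrow>\<^bsub>G\<^esub> w" if "u \<in> A" "w \<in> A" "u \<noteq> w" for u w
      using that A by (auto simp: clique_def)
    moreover have "u \<rightarrow>\<^bsub>G\<^esub> w" if "u \<in> NB a0" "w \<in> NB a0" "u \<noteq> w" for u w
      using that B by (auto simp: clique_def NB_def)
    ultimately show "u \<rightarrow>\<^bsub>G\<^esub> w"
      using complete adj_sym unfolding Q_def by (metis UnE UnI1 UnI2 insertE)
  qed
  have "s - 2 \<le> card (A - {a0})" using a0 fin large by simp
  then obtain A' where A': "A' \<subseteq> A - {a0}" "card A' = s - 2" "finite A'"
    by (rule obtain_subset_with_card_n)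
  define K where "K = insert v (insert a0 A')"
  have KQ: "K \<subseteq> Q" using A' a0 by (auto simp: K_def Q_def)
  then have K: "clique G K" using Q by (auto simp: clique_def)
  have KV: "K \<subseteq> verts G" using K by (simp add: clique_def)
  have cardK: "card K = s"
    using A' a0 vnot \<open>s \<ge> 2\<close> unfolding K_def by (subst card_insert_disjoint; auto)+
  have "s \<le> chromatic_number (G \<restriction> K)"
    using card_clique_le_chromatic_number_induce[OF K] cardK by simp
  \<comment> \<open>\<open>K\<close> itself is tried as the first part of a splitting.\<close>
  then have "chromatic_number (G \<restriction> (verts G - K)) < t"
    using splittableI[of K "verts G - K" s t] KV ns by force
  then have "chromatic_number (G \<restriction> (verts G - K)) \<le> t - 1" by simp
  then obtain c where c: "\<forall>u\<in>verts G - K. c u < t - 1"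
      "\<forall>u\<in>verts G - K. \<forall>w\<in>verts G - K. u \<rightarrow>\<^bsub>G\<^esub> w \<longrightarrow> c u \<noteq> c w"
    using chromatic_number_induce_le_iff[of "verts G - K" "t - 1"] by blast
  have "{..<t - 1} \<subseteq> c ` (Q - K)"
  proof
    fix i assume "i \<in> {..<t - 1}"
    moreover have "t - 1 + card K \<le> chromatic_number G" using cardK chrom \<open>t \<ge> 1\<close> by simp
    moreover have "v \<in> K" "a0 \<in> K" "v \<noteq> a0" using a0 vnot by (auto simp: K_def)
    ultimately obtain z where z: "z \<in> verts G - K" "c z = i" "v \<rightarrow>\<^bsub>G\<^esub> z" "a0 \<rightarrow>\<^bsub>G\<^esub> z"
      using common_neighbor_of_color[OF K _ _ _ _ c, of v a0 i] by auto
    \<comment> \<open>Being adjacent to \<open>v\<close>, \<open>z\<close> lies in \<open>A\<close>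
      or \<open>B\<close>; in the latter case adjacency to \<open>a0\<close> puts it in
      \<open>NB a0\<close>.\<close>
    then have "z \<in> A \<union> NB a0" using vA[of z] by (auto simp: NB_def)
    then show "i \<in> c ` (Q - K)" using z by (auto simp: Q_def)
  qed
  moreover have finQ: "finite Q" using fin by (auto simp: Q_def NB_def)
  ultimately have "t - 1 \<le> card (Q - K)"
    by (metis card_lessThan finite_Diff surj_card_le)
  then have "s + t - 1 \<le> card Q"
    using card_Diff_subset[of K Q] KQ finQ cardK finite_subset[OF KQ finQ] card_mono[OF finQ KQ]
      \<open>t \<ge> 1\<close> by simp
  then show False using clique_number_le_iff[of "clique_number G"] Q omega chrom by fastforce
qed

section \<open>Reduction to a vertex-critical induced subgraph\<close>

theorem theorem1p4:
  fixes G :: "('a, 'b) pre_digraph" and s t :: nat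
  assumes "s \<ge> 2" and "t \<ge> 2"
    and "graph G"
    and "C4_free G"
    and "\<forall>H. induced_subgraph H G \<and> verts H \<noteq> {} \<longrightarrow> (\<exists>v. bisimplicial H v)"
    and "clique_number G < chromatic_number G"
    and "chromatic_number G = s + t - 1"
  shows "splittable s t G"
proof -
  interpret graph G by fact
  let ?k = "s + t - 1"
  \<comment> \<open>Asking for at least \<open>?k\<close> rather than equality lets
    \<open>Umin\<close> refute any smaller set directly; equality returns by monotonicity.\<close>
  obtain U where U: "U \<subseteq> verts G" "?k \<le> chromatic_number (G \<restriction> U)"
    and Umin: "\<And>W. W \<subseteq> verts G \<Longrightarrow> ?k \<le> chromatic_number (G \<restriction> W) \<Longrightarrow> card U \<le> card W"
    using ex_has_least_nat[of "\<lambda>W. W \<subseteq> verts G \<and> ?k \<le> chromatic_number (G \<restriction> W)" "verts G" card]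
      assms(7) induce_verts by auto
  define H where "H = G \<restriction> U"
  interpret H: graph H unfolding H_def using U(1) by (rule graph_induce)
  have indH: "induced_subgraph H G" unfolding H_def using U(1) by (rule induced_induce)
  have vH: "verts H = U" by (simp add: H_def)
  have "chromatic_number H \<le> chromatic_number (G \<restriction> verts G)"
    unfolding H_def using U(1) by (intro chromatic_number_induce_mono) auto
  then have chrom: "chromatic_number H = ?k"
    using U(2) assms(7) by (simp add: induce_verts H_def)
  have "clique G K" if "clique H K" for K
    using that U(1) by (auto simp: clique_def H_def adj_induce_iff)
  then have "clique_number H \<le> clique_number G"
    using clique_number_le_iff[of "clique_number G"] H.clique_number_le_iff by blast
  then have omega: "clique_number H < chromatic_number H" using assms(6,7) chrom by simp
  have C4: "C4_free H"
    using assms(4) induced_subgraph_trans[OF _ indH] by (auto simp: C4_free_def)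
  have "U \<noteq> {}"
  proof
    assume "U = {}"
    then have "chromatic_number (G \<restriction> U) \<le> 0" by (subst chromatic_number_induce_le_iff) auto
    then show False using U(2) assms(1) by simp
  qed
  then obtain v K L where v: "v \<in> verts H" and KL: "clique H K" "clique H L"
      "neighbors H v = K \<union> L"
    using assms(5) indH vH unfolding bisimplicial_def by blast
  \<comment> \<open>The two cliques may overlap; \<open>splittable_of_large_side\<close> wants them
    disjoint.\<close>
  have L': "clique H (L - K)" using KL(2) by (auto simp: clique_def)
  have N: "neighbors H v = K \<union> (L - K)" using KL(3) by auto
  have "chromatic_number (H \<restriction> (verts H - {v})) < chromatic_number H"
  proof (rule ccontr)
    assume "\<not> ?thesis"
    then have "?k \<le> chromatic_number (G \<restriction> (U - {v}))"
      using chrom by (simp add: H_def vH induce_induce)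
    then have "card U \<le> card (U - {v})" using U(1) by (intro Umin) auto
    then show False using v vH U(1) finite_verts
      by (metis card_Diff1_less finite_subset leD)
  qed
  then have "?k \<le> Suc (card (neighbors H v))"
    using H.chromatic_number_le_Suc_degree[OF v] chrom by simp
  also have "card (neighbors H v) \<le> card K + card (L - K)"
    unfolding N by (rule card_Un_le)
  \<comment> \<open>If both bounds failed, the degree of \<open>v\<close> would be at most
    \<open>s + t - 4\<close>, below the required \<open>s + t - 2\<close>.\<close>
  finally consider "s - 1 \<le> card K" | "t - 1 \<le> card (L - K)" using assms(1,2) by linarith
  then have "splittable s t H"
  proof cases
    case 1
    then show ?thesis
      using assms(1,2) chrom by (intro H.splittable_of_large_side[OF C4 omega _ _ _ v KL(1) L' _ N]) auto
  next
    case 2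
    then have "splittable t s H"
      using assms(1,2) chrom N
      by (intro H.splittable_of_large_side[OF C4 omega _ _ _ v L' KL(1)]) auto
    then show ?thesis by (simp add: splittable_commute)
  qed
  then show ?thesis using splittable_induce[OF U(1)] by (simp add: H_def)
qed

end
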